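(* Let $G=(V,E)$ be a finite connected graph (parallel edges allowed, no loops) with at least two vertices. Let $F$ be a two-forest of $G$ chosen uniformly at random among all two-forests of $G$, and let $\partial F$ be its cut set. Then \[ \mathbb{E}(|\partial F|) \;\leq\; 2\,(\mathrm{avg.deg})\left(1+\frac{1}{|V|-1}\right), \] where $\mathrm{avg.deg} = \frac{1}{|V|}\sum_{v\in V}\deg v = 2|E|/|V|$ is the average degree of $G$.
   Context: A two-forest of $G$ is a spanning subgraph with no cycles having exactly two connected components. If the components of a two-forest $F$ have vertex sets $A$ and $B$ (so $V=A\sqcup B$), the cut set $\partial F$ is the set of edges of $G$ with one endpoint in $A$ and the other in $B$. *)

theory Defs
  imports "HOL-Probability.Probability"
begin

text \<open>
  Undirected multigraphs: edges are abstract objects, each carrying its set of end vertices, so that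
  distinct edges may have the same ends. Loops are excluded by requiring exactly two ends.
\<close>

record ('v, 'e) multigraph =
  verts :: "'v set"
  edges :: "'e set"
  ends :: "'e \<Rightarrow> 'v set"

definition finite_multigraph :: "('v, 'e) multigraph \<Rightarrow> bool" where
  "finite_multigraph G \<longleftrightarrow> finite (verts G) \<and> finite (edges G) \<and>
     (\<forall>e\<in>edges G. ends G e \<subseteq> verts G \<and> card (ends G e) = 2)"

definition adjacency :: "('v, 'e) multigraph \<Rightarrow> ('v \<times> 'v) set" where
  "adjacency G = {(u, v). \<exists>e\<in>edges G. ends G e = {u, v}}"

definition graph_components :: "('v, 'e) multigraph \<Rightarrow> 'v set set" where
  "graph_components G = (\<lambda>v. {u \<in> verts G. (v, u) \<in> (adjacency G)\<^sup>*}) ` verts G"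

definition connected_graph :: "('v, 'e) multigraph \<Rightarrow> bool" where
  "connected_graph G \<longleftrightarrow> (\<forall>u\<in>verts G. \<forall>v\<in>verts G. (u, v) \<in> (adjacency G)\<^sup>*)"

text \<open>
  A cycle is given by its distinct vertices and distinct edges in cyclic order, edge number \<open>i\<close> joining
  vertex number \<open>i\<close> to the next one. Two parallel edges form a cycle of length 2.
\<close>

definition is_cycle :: "('v, 'e) multigraph \<Rightarrow> 'v list \<Rightarrow> 'e list \<Rightarrow> bool" where
  "is_cycle G vs es \<longleftrightarrow> es \<noteq> [] \<and> length vs = length es \<and> distinct vs \<and> distinct es \<and>
     set vs \<subseteq> verts G \<and> set es \<subseteq> edges G \<and>
     (\<forall>i<length es. ends G (es ! i) = {vs ! i, vs ! (Suc i mod length es)})"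

definition acyclic_graph :: "('v, 'e) multigraph \<Rightarrow> bool" where
  "acyclic_graph G \<longleftrightarrow> (\<nexists>vs es. is_cycle G vs es)"

text \<open>A spanning subgraph of \<open>G\<close> is identified with its edge set.\<close>

definition spanning_subgraph :: "('v, 'e) multigraph \<Rightarrow> 'e set \<Rightarrow> ('v, 'e) multigraph" where
  "spanning_subgraph G F = G\<lparr>edges := F\<rparr>"

definition two_forests :: "('v, 'e) multigraph \<Rightarrow> 'e set set" where
  "two_forests G = {F. F \<subseteq> edges G \<and> acyclic_graph (spanning_subgraph G F) \<and>
     card (graph_components (spanning_subgraph G F)) = 2}"

definition cut_set :: "('v, 'e) multigraph \<Rightarrow> 'e set \<Rightarrow> 'e set" where
  "cut_set G F = {e \<in> edges G. \<exists>A \<in> graph_components (spanning_subgraph G F).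
     \<exists>B \<in> graph_components (spanning_subgraph G F).
       A \<noteq> B \<and> (\<exists>a\<in>A. \<exists>b\<in>B. ends G e = {a, b})}"

definition degree :: "('v, 'e) multigraph \<Rightarrow> 'v \<Rightarrow> nat" where
  "degree G v = card {e \<in> edges G. v \<in> ends G e}"

definition avg_deg :: "('v, 'e) multigraph \<Rightarrow> real" where
  "avg_deg G = (\<Sum>v\<in>verts G. real (degree G v)) / real (card (verts G))"

lemma avg_deg_eq:
  assumes "finite_multigraph G"
  shows "avg_deg G = 2 * real (card (edges G)) / real (card (verts G))"
proof -
  have fin: "finite (verts G)" "finite (edges G)"
    using assms by (auto simp: finite_multigraph_def)
  have "(\<Sum>v\<in>verts G. degree G v) = (\<Sum>v\<in>verts G. \<Sum>e\<in>edges G. if v \<in> ends G e then 1 else 0)"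
    by (simp add: degree_def fin sum.If_cases Int_def)
  also have "\<dots> = (\<Sum>e\<in>edges G. \<Sum>v\<in>verts G. if v \<in> ends G e then 1 else 0)"
    by (rule sum.swap)
  also have "\<dots> = (\<Sum>e\<in>edges G. card (verts G \<inter> ends G e))"
    by (simp add: fin sum.If_cases Int_def)
  also have "\<dots> = (\<Sum>e\<in>edges G. 2)"
    using assms by (intro sum.cong) (auto simp: finite_multigraph_def Int_absorb1)
  finally have "(\<Sum>v\<in>verts G. degree G v) = 2 * card (edges G)"
    by simp
  then have "(\<Sum>v\<in>verts G. real (degree G v)) = 2 * real (card (edges G))"
    by (metis of_nat_mult of_nat_numeral of_nat_sum)
  then show ?thesis
    by (simp add: avg_deg_def)
qed

end

theory Submission
  imports Defs
begin

text \<open>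
  Write \<open>\<kappa>\<close> for the number of spanning trees, \<open>\<kappa>\<^sub>2\<close> for the number of two-forests and \<open>R e\<close> for the
  number of two-forests separating the ends of \<open>e\<close>, which is also the number of spanning trees
  through \<open>e\<close>. Counting trees by edges, the cut sizes sum to \<open>\<Sum>e. R e = (|V| - 1) \<kappa>\<close>, so by
  Cauchy--Schwarz it suffices that \<open>4 \<kappa> \<kappa>\<^sub>2 \<ge> \<Sum>e. (R e)\<^sup>2\<close>.

  Fix a vertex \<open>q\<close> and let \<open>g x y\<close> be the number of two-forests in which \<open>x\<close> and \<open>y\<close> lie together away
  from \<open>q\<close>; put \<open>h x = g x x\<close>. Then \<open>g / \<kappa>\<close> is the Green function of the Laplacian grounded at \<open>q\<close>.
  In a two-forest the tree avoiding \<open>q\<close> has one vertex more than edges, so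
  \<open>\<kappa>\<^sub>2 = \<Sum>v. h v - \<Sum>e. N e\<close>, where \<open>N e\<close> counts the two-forests having the edge \<open>e\<close> in that tree.
  Grounding a second vertex gives \<open>\<kappa> N e = h u h w - (g u w)\<^sup>2\<close> for \<open>e = uw\<close>. As
  \<open>R e = h u + h w - 2 g u w\<close>, summation by parts yields the identity
  \<open>\<kappa> \<kappa>\<^sub>2 = \<Sum>e. (R e)\<^sup>2 / 4 + 3 / 4 (h u - h w)\<^sup>2\<close>.
\<close>

section \<open>Double counting, connectivity and forests\<close>

lemma sum_card_swap:
  assumes "finite A" "finite B"
  shows "(\<Sum>a\<in>A. card {b \<in> B. P a b}) = (\<Sum>b\<in>B. card {a \<in> A. P a b})"
  using sum.swap_restrict[OF assms, of "\<lambda>_ _. 1::nat" P] by simp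

lemma real_card_filter: "finite A \<Longrightarrow> real (card {a \<in> A. P a}) = (\<Sum>a\<in>A. of_bool (P a))"
  by (simp add: Int_def)

text \<open>The orientation is arbitrary and only gives names to the two ends of an edge;
  \<open>joins\<close>, and with it connectivity, ignores the direction.\<close>

locale oriented_multigraph =
  fixes V :: "'v set" and E :: "'e set" and s t :: "'e \<Rightarrow> 'v"
  assumes finite_V: "finite V" and finite_E: "finite E"
    and s_in: "e \<in> E \<Longrightarrow> s e \<in> V" and t_in: "e \<in> E \<Longrightarrow> t e \<in> V"
    and s_neq_t: "e \<in> E \<Longrightarrow> s e \<noteq> t e"
begin

definition joins :: "'e \<Rightarrow> 'v \<Rightarrow> 'v \<Rightarrow> bool" where
  "joins e x y \<longleftrightarrow> s e = x \<and> t e = y \<or> s e = y \<and> t e = x"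

definition conn :: "'e set \<Rightarrow> 'v \<Rightarrow> 'v \<Rightarrow> bool" where
  "conn F x y \<longleftrightarrow> (x, y) \<in> {(u, v). \<exists>e\<in>F. joins e u v}\<^sup>*"

lemma joins_sym: "joins e x y \<Longrightarrow> joins e y x"
  by (auto simp: joins_def)

lemma joins_ends: "joins e (s e) (t e)"
  by (simp add: joins_def)

lemma conn_refl [simp]: "conn F x x"
  by (simp add: conn_def)

lemma conn_trans: "conn F x y \<Longrightarrow> conn F y z \<Longrightarrow> conn F x z"
  unfolding conn_def by (rule rtrancl_trans)

lemma conn_sym: "conn F x y \<Longrightarrow> conn F y x"
  unfolding conn_def
  by (rule symD[OF sym_rtrancl]) (auto simp: sym_def intro: joins_sym)

lemma conn_commute: "conn F x y \<longleftrightarrow> conn F y x"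
  by (blast intro: conn_sym)

lemma conn_joins: "e \<in> F \<Longrightarrow> joins e x y \<Longrightarrow> conn F x y"
  unfolding conn_def by (rule r_into_rtrancl) auto

lemma conn_mono: "conn F x y \<Longrightarrow> F \<subseteq> F' \<Longrightarrow> conn F' x y"
  unfolding conn_def by (erule rtrancl_mono[THEN subsetD, rotated]) auto

lemma conn_induct [consumes 1, case_names refl step]:
  assumes "conn F x y" "P x" "\<And>y z e. conn F x y \<Longrightarrow> P y \<Longrightarrow> e \<in> F \<Longrightarrow> joins e y z \<Longrightarrow> P z"
  shows "P y"
  using assms(1) unfolding conn_def
  by (induction rule: rtrancl_induct) (auto intro: assms(2) assms(3) simp: conn_def)

text \<open>A walk that crosses \<open>e\<close> several times can be shortened to at most one
  crossing, in one of the two directions.\<close>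

lemma conn_insert:
  assumes "joins e x y"
  shows "conn (insert e F) a b \<longleftrightarrow>
    conn F a b \<or> conn F a x \<and> conn F y b \<or> conn F a y \<and> conn F x b" (is "_ \<longleftrightarrow> ?R b")
proof
  assume "conn (insert e F) a b"
  then show "?R b"
  proof (induction rule: conn_induct)
    case refl
    show ?case by simp
  next
    case (step c d f)
    show ?case
    proof (cases "f \<in> F")
      case True
      then have "conn F c d" using step by (blast intro: conn_joins)
      then show ?thesis using step.IH by (blast intro: conn_trans)
    next
      case False
      then have "c = x \<and> d = y \<or> c = y \<and> d = x" using step assms by (auto simp: joins_def)
      then show ?thesis using step.IH by (auto intro: conn_sym conn_trans)
    qed
  qed
next
  have "conn (insert e F) x y" by (rule conn_joins[OF _ assms]) simp
  moreover have "\<And>u v. conn F u v \<Longrightarrow> conn (insert e F) u v" by (rule conn_mono) auto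
  moreover assume "?R b"
  ultimately show "conn (insert e F) a b" by (meson conn_sym conn_trans)
qed

text \<open>Acyclicity in the form that every edge is a bridge, which avoids handling cycles as
  lists; \<open>forest_imp_acyclic_graph\<close> and \<open>acyclic_graph_imp_forest\<close> relate
  it to \<open>acyclic_graph\<close>.\<close>

definition forest :: "'e set \<Rightarrow> bool" where
  "forest F \<longleftrightarrow> F \<subseteq> E \<and> (\<forall>e\<in>F. \<not> conn (F - {e}) (s e) (t e))"

lemma forest_subset_E: "forest F \<Longrightarrow> F \<subseteq> E"
  by (simp add: forest_def)

lemma finite_forest: "forest F \<Longrightarrow> finite F"
  using finite_E finite_subset forest_subset_E by blast

lemma forest_joins:
  assumes "forest F" "e \<in> F" "joins e x y"
  shows "\<not> conn (F - {e}) x y"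
  using assms by (auto simp: forest_def joins_def dest: conn_sym)

lemma forest_subset: "forest F \<Longrightarrow> F' \<subseteq> F \<Longrightarrow> forest F'"
  unfolding forest_def by (meson Diff_mono conn_mono order_refl subset_iff)

text \<open>If an old edge \<open>f\<close> stopped being a bridge, its ends would be linked through
  \<open>e\<close> without \<open>f\<close>; going round the other way along \<open>f\<close> would
  then link \<open>x\<close> and \<open>y\<close> in \<open>F\<close>.\<close>

lemma forest_insert:
  assumes "forest F" "e \<in> E" "joins e x y" "\<not> conn F x y"
  shows "forest (insert e F)"
  unfolding forest_def
proof (intro conjI ballI)
  show "insert e F \<subseteq> E" using assms forest_subset_E by auto
next
  fix f assume f: "f \<in> insert e F"
  have "e \<notin> F" using assms conn_joins by blast
  show "\<not> conn (insert e F - {f}) (s f) (t f)"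
  proof (cases "f = e")
    case True
    then have "insert e F - {f} = F" using \<open>e \<notin> F\<close> by auto
    then show ?thesis using True assms by (auto simp: joins_def dest: conn_sym)
  next
    case False
    then have fF: "f \<in> F" using f by auto
    have eq: "insert e F - {f} = insert e (F - {f})" using False by auto
    have nc: "\<not> conn (F - {f}) (s f) (t f)" using assms(1) fF by (simp add: forest_def)
    have fc: "conn F (s f) (t f)" by (rule conn_joins[OF fF joins_ends])
    have m: "\<And>u v. conn (F - {f}) u v \<Longrightarrow> conn F u v" by (rule conn_mono) auto
    show ?thesis unfolding eq conn_insert[OF assms(3)]
      using nc fc m assms(4) by (meson conn_sym conn_trans)
  qed
qed

text \<open>Induction on the edges: a new edge either lies outside the tree of \<open>a\<close> or
  fuses two trees, and then \<open>e\<close> itself makes up for one of the two surplus vertices.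
  Both ends of an edge lie in one tree, so edges are counted through \<open>s\<close>.\<close>

lemma card_component:
  assumes "forest F" "a \<in> V"
  shows "card {v \<in> V. conn F a v} = Suc (card {e \<in> F. conn F a (s e)})"
proof -
  have "finite F" using assms finite_forest by blast
  then show ?thesis using assms
  proof (induction F arbitrary: a rule: finite_induct)
    case empty
    have "{v \<in> V. conn {} a v} = {a}" using empty by (auto simp: conn_def)
    then show ?case by simp
  next
    case (insert e F)
    have FF: "forest F" using insert.prems forest_subset by blast
    have eE: "e \<in> E" using insert.prems forest_subset_E by blast
    let ?x = "s e" and ?y = "t e"
    have xV: "?x \<in> V" "?y \<in> V" using eE s_in t_in by auto
    have nxy: "\<not> conn F ?x ?y" using insert.prems insert.hyps unfolding forest_def by force
    have ci: "\<And>a b. conn (insert e F) a b \<longleftrightarrow>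
      conn F a b \<or> conn F a ?x \<and> conn F ?y b \<or> conn F a ?y \<and> conn F ?x b"
      by (rule conn_insert[OF joins_ends])
    define C where "C b = {v \<in> V. conn F b v}" for b
    define D where "D b = {f \<in> F. conn F b (s f)}" for b
    have IH: "card (C b) = Suc (card (D b))" if "b \<in> V" for b
      unfolding C_def D_def by (rule insert.IH[OF FF that])
    have fin: "finite (C b)" "finite (D b)" for b
      using finite_V insert.hyps by (auto simp: C_def D_def)
    show ?case
    proof (cases "conn F a ?x \<or> conn F a ?y")
      case True
      have 1: "{v \<in> V. conn (insert e F) a v} = C ?x \<union> C ?y"
        using True by (auto simp: ci C_def intro: conn_sym conn_trans)
      have 2: "{f \<in> insert e F. conn (insert e F) a (s f)} = insert e (D ?x \<union> D ?y)"
        using True by (auto simp: ci D_def intro: conn_sym conn_trans)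
      have 3: "C ?x \<inter> C ?y = {}" "D ?x \<inter> D ?y = {}"
        using nxy by (auto simp: C_def D_def dest: conn_sym conn_trans)
      have "e \<notin> D ?x \<union> D ?y" using insert.hyps by (auto simp: D_def)
      then show ?thesis unfolding 1 2
        using IH[OF xV(1)] IH[OF xV(2)] 3 fin by (simp add: card_Un_disjoint)
    next
      case False
      have 1: "{v \<in> V. conn (insert e F) a v} = C a" using False by (auto simp: ci C_def)
      have 2: "{f \<in> insert e F. conn (insert e F) a (s f)} = D a"
        using False by (auto simp: ci D_def)
      show ?thesis unfolding 1 2 using IH[OF insert.prems(2)] .
    qed
  qed
qed

text \<open>\<open>e\<close> is the first edge on the path from \<open>a\<close> to
  \<open>b\<close>. The rest of the path avoids all edges at \<open>a\<close>, so deleting another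
  edge there does not cut it.\<close>

lemma unique_separating_edge:
  assumes "forest F" "conn F a b" "a \<noteq> b"
  obtains e where "\<And>f. f \<in> F \<Longrightarrow> s f = a \<or> t f = a \<Longrightarrow> \<not> conn (F - {f}) a b \<longleftrightarrow> f = e"
    and "e \<in> F" "s e = a \<or> t e = a"
proof -
  let ?F' = "{f \<in> F. s f \<noteq> a \<and> t f \<noteq> a}"
  \<comment> \<open>Invariant along the walk: the piece after the last visit to \<open>a\<close>
    uses no edge at \<open>a\<close>.\<close>
  have "b = a \<or> (\<exists>e\<in>F. \<exists>y. joins e a y \<and> conn ?F' y b)"
    using assms(2)
  proof (induction rule: conn_induct)
    case refl
    show ?case by simp
  next
    case (step c d f)
    show ?case
    proof (cases "c = a \<or> d = a")
      case True
      then show ?thesis using step by (auto intro: conn_refl)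
    next
      case False
      then have "conn ?F' c d" using step by (intro conn_joins[of f]) (auto simp: joins_def)
      then show ?thesis using step False by (blast intro: conn_trans)
    qed
  qed
  then obtain e y where e: "e \<in> F" "joins e a y" "conn ?F' y b" using assms by auto
  have yb: "conn (F - {f}) y b" if "s f = a \<or> t f = a" for f
    by (rule conn_mono[OF e(3)]) (use that in auto)
  have ea: "s e = a \<or> t e = a" using e by (auto simp: joins_def)
  show thesis
  proof (rule that[of e])
    fix f assume f: "f \<in> F" "s f = a \<or> t f = a"
    show "\<not> conn (F - {f}) a b \<longleftrightarrow> f = e"
    proof
      assume n: "\<not> conn (F - {f}) a b"
      show "f = e"
      proof (rule ccontr)
        assume "f \<noteq> e"
        then have "conn (F - {f}) a y" using e by (intro conn_joins[of e]) auto
        then show False using n yb[OF f(2)] conn_trans by blast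
      qed
    next
      assume "f = e"
      then show "\<not> conn (F - {f}) a b"
        using forest_joins[OF assms(1) e(1,2)] yb[OF ea] by (blast intro: conn_sym conn_trans)
    qed
  qed (use e ea in auto)
qed

section \<open>Forests with one root from \<open>Q\<close> in each tree\<close>

definition rooted_forests :: "'v set \<Rightarrow> 'e set set" where
  "rooted_forests Q = {F. forest F \<and> (\<forall>v\<in>V. \<exists>!r. r \<in> Q \<and> conn F v r)}"

lemma finite_rooted_forests: "finite (rooted_forests Q)"
  by (rule finite_subset[of _ "Pow E"])
    (auto simp: rooted_forests_def finite_E dest: forest_subset_E)

text \<open>\<open>e\<close> hooks the tree of \<open>w\<close> onto another tree, whose root in
  \<open>Q\<close> takes over for both, so \<open>w\<close> ceases to be a root.\<close>

lemma rooted_forests_insert_edge: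
  assumes F: "F \<in> rooted_forests (insert w Q)" and Q: "Q \<subseteq> V" "w \<in> V" "w \<notin> Q"
    and e: "e \<in> E" "joins e x y" and x: "conn F w x" and y: "\<not> conn F w y"
  shows "e \<notin> F" "insert e F \<in> rooted_forests Q"
proof -
  have fF: "forest F" and ex: "\<And>v. v \<in> V \<Longrightarrow> \<exists>r. (r = w \<or> r \<in> Q) \<and> conn F v r"
    and un: "\<And>v r r'. v \<in> V \<Longrightarrow> r = w \<or> r \<in> Q \<Longrightarrow> conn F v r \<Longrightarrow> r' = w \<or> r' \<in> Q \<Longrightarrow> conn F v r' \<Longrightarrow> r = r'"
    using F unfolding rooted_forests_def by blast+
  have xy: "\<not> conn F x y" using x y conn_trans by blast
  show "e \<notin> F" using xy e conn_joins by blast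
  have yV: "y \<in> V" using e by (auto simp: joins_def intro: s_in t_in)
  obtain r where r: "r \<in> Q" "conn F y r" using ex[OF yV] y conn_sym by blast
  have ci: "\<And>a b. conn (insert e F) a b \<longleftrightarrow>
      conn F a b \<or> conn F a x \<and> conn F y b \<or> conn F a y \<and> conn F x b"
    by (rule conn_insert[OF e(2)])
  have "\<exists>!r. r \<in> Q \<and> conn (insert e F) v r" if v: "v \<in> V" for v
  proof -
    have nwQ: "\<not> conn F w r'" if "r' \<in> Q" for r'
      using un[OF \<open>w \<in> V\<close>, of w r'] that Q by auto
    have nxQ: "\<not> conn F x r'" if "r' \<in> Q" for r'
      using nwQ[OF that] x conn_trans by blast
    show ?thesis
    proof (cases "conn F v w")
      case True
      then have vx: "conn F v x" using x conn_trans by blast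
      have "r' \<in> Q \<and> conn (insert e F) v r' \<longleftrightarrow> r' = r" for r'
      proof
        assume "r' \<in> Q \<and> conn (insert e F) v r'"
        then have "r' \<in> Q" "conn F y r'"
          using nxQ vx unfolding ci by (meson conn_sym conn_trans)+
        then show "r' = r" using un[OF yV] r by blast
      next
        assume "r' = r"
        then show "r' \<in> Q \<and> conn (insert e F) v r'" using r vx by (auto simp: ci)
      qed
      then show ?thesis by auto
    next
      case False
      then have vx: "\<not> conn F v x" using x by (meson conn_sym conn_trans)
      obtain r' where r': "r' \<in> Q" "conn F v r'" using ex[OF v] False by blast
      have "r'' \<in> Q \<and> conn (insert e F) v r'' \<longleftrightarrow> r'' = r'" for r''
        using vx nxQ un[OF v] r' by (auto simp: ci)
      then show ?thesis by auto
    qed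
  qed
  then show "insert e F \<in> rooted_forests Q"
    using forest_insert[OF fF e xy] by (simp add: rooted_forests_def)
qed

text \<open>Converse of the insertion: the piece cut off from \<open>Q\<close> is the one holding
  \<open>w\<close>, which becomes its root.\<close>

lemma rooted_forests_delete_edge:
  assumes T: "T \<in> rooted_forests Q" and e: "e \<in> T" and w: "w \<in> V"
    and sep: "\<And>r. r \<in> Q \<Longrightarrow> \<not> conn (T - {e}) w r"
  shows "T - {e} \<in> rooted_forests (insert w Q)"
proof -
  let ?F = "T - {e}"
  have fT: "forest T" and ex: "\<And>v. v \<in> V \<Longrightarrow> \<exists>r. r \<in> Q \<and> conn T v r"
    and un: "\<And>v r r'. v \<in> V \<Longrightarrow> r \<in> Q \<Longrightarrow> conn T v r \<Longrightarrow> r' \<in> Q \<Longrightarrow> conn T v r' \<Longrightarrow> r = r'"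
    using T unfolding rooted_forests_def by blast+
  have T_eq: "T = insert e ?F" using e by auto
  have ci: "conn T a b \<longleftrightarrow>
      conn ?F a b \<or> conn ?F a x \<and> conn ?F y b \<or> conn ?F a y \<and> conn ?F x b" if "joins e x y" for a b x y
    by (subst T_eq) (rule conn_insert[OF that])
  have m: "\<And>a b. conn ?F a b \<Longrightarrow> conn T a b" by (rule conn_mono) auto
  obtain r where r: "r \<in> Q" "conn T w r" using ex[OF w] by blast
  \<comment> \<open>\<open>e\<close> lies on the path from \<open>w\<close> to its root
    \<open>r\<close>; the names are chosen so that \<open>x\<close> is the end on the side of
    \<open>w\<close>.\<close>
  obtain x y where xy: "joins e x y" "conn ?F w x" "conn ?F y r"
    using r(2) sep[OF r(1)] ci[OF joins_ends] joins_ends joins_sym by metis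
  have "\<exists>!r. r \<in> insert w Q \<and> conn ?F v r" if v: "v \<in> V" for v
  proof -
    obtain r' where r': "r' \<in> Q" "conn T v r'" using ex[OF v] by blast
    have "\<exists>r. r \<in> insert w Q \<and> conn ?F v r"
      using r' sep[OF r'(1)] xy(2) ci[OF xy(1), of v r'] by (meson conn_sym conn_trans insertI1 insertI2)
    moreover have "a = b" if "a \<in> insert w Q" "conn ?F v a" "b \<in> insert w Q" "conn ?F v b" for a b
    proof -
      have "conn ?F a b" using that by (meson conn_sym conn_trans)
      then show ?thesis using that sep un[OF v] m by (metis conn_sym insertE)
    qed
    ultimately show ?thesis by blast
  qed
  then show ?thesis using forest_subset[OF fT] by (auto simp: rooted_forests_def)
qed

section \<open>The Green function and its Laplacian\<close>

definition other :: "'e \<Rightarrow> 'v \<Rightarrow> 'v" where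
  "other e x = (if s e = x then t e else s e)"

definition incident :: "'v \<Rightarrow> 'e set" where
  "incident x = {e \<in> E. s e = x \<or> t e = x}"

lemma joins_other: "e \<in> incident x \<Longrightarrow> joins e x (other e x)"
  by (auto simp: incident_def joins_def other_def)

lemma finite_incident: "finite (incident x)"
  using finite_E by (simp add: incident_def)

text \<open>For \<open>w \<notin> Q\<close>, and divided by the number of forests rooted at \<open>Q\<close>, this is the Green function
  of the Laplacian grounded at \<open>Q\<close>.\<close>

definition green :: "'v set \<Rightarrow> 'v \<Rightarrow> 'v \<Rightarrow> nat" where
  "green Q w x = card {F \<in> rooted_forests (insert w Q). conn F w x}"

text \<open>In other words, the path in \<open>T\<close> from \<open>w\<close> to its root in \<open>Q\<close> leaves \<open>x\<close> along \<open>e\<close>.\<close>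

definition departs :: "'v set \<Rightarrow> 'v \<Rightarrow> 'v \<Rightarrow> 'e \<Rightarrow> 'e set \<Rightarrow> bool" where
  "departs Q w x e T \<longleftrightarrow> e \<in> T \<and> conn (T - {e}) w x \<and> (\<forall>r\<in>Q. \<not> conn (T - {e}) w r)"

text \<open>Inserting and deleting \<open>e\<close> are mutually inverse. In a forest on the left
  \<open>e\<close> would link the tree of \<open>w\<close> to another one, so after insertion the
  path from \<open>w\<close> to its root must cross \<open>e\<close>, coming from
  \<open>x\<close>.\<close>

lemma card_insert_edge:
  assumes Q: "Q \<subseteq> V" "w \<in> V" "w \<notin> Q" and e: "e \<in> E" "joins e x y"
  shows "card {F \<in> rooted_forests (insert w Q). conn F w x \<and> \<not> conn F w y} =
    card {T \<in> rooted_forests Q. departs Q w x e T}"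
proof (rule bij_betw_same_card[of "insert e"], rule bij_betw_byWitness[where f' = "\<lambda>T. T - {e}"])
  let ?A = "{F \<in> rooted_forests (insert w Q). conn F w x \<and> \<not> conn F w y}"
  let ?B = "{T \<in> rooted_forests Q. departs Q w x e T}"
  have ins: "e \<notin> F" "insert e F \<in> rooted_forests Q" if "F \<in> ?A" for F
    using rooted_forests_insert_edge[OF _ Q e] that by auto
  show "\<forall>F\<in>?A. insert e F - {e} = F" using ins by auto
  show "\<forall>T\<in>?B. insert e (T - {e}) = T" by (auto simp: departs_def)
  show "insert e ` ?A \<subseteq> ?B"
  proof safe
    fix F assume F: "F \<in> rooted_forests (insert w Q)" "conn F w x" "\<not> conn F w y"
    then have eF: "e \<notin> F" "insert e F \<in> rooted_forests Q" using ins by auto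
    have "\<not> conn F w r" if "r \<in> Q" for r
      using F(1) Q that conn_refl[of F w] unfolding rooted_forests_def by blast
    then show "insert e F \<in> rooted_forests Q" "departs Q w x e (insert e F)"
      using F eF by (auto simp: departs_def)
  qed
  show "(\<lambda>T. T - {e}) ` ?B \<subseteq> ?A"
  proof safe
    fix T assume T: "T \<in> rooted_forests Q" "departs Q w x e T"
    then show "T - {e} \<in> rooted_forests (insert w Q)" "conn (T - {e}) w x"
      using rooted_forests_delete_edge[OF T(1) _ Q(2)] by (auto simp: departs_def)
    assume "conn (T - {e}) w y"
    then have "conn (T - {e}) x y" using T by (meson conn_sym conn_trans departs_def)
    moreover have "forest T" "e \<in> T" using T by (auto simp: rooted_forests_def departs_def)
    ultimately show False using forest_joins e by blast
  qed
qed

text \<open>The edges on the path from \<open>w\<close> to its root leave \<open>x\<close> as often as they enter it,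
  except for one extra departure at \<open>x = w\<close>.\<close>

lemma card_departs:
  assumes T: "T \<in> rooted_forests Q" and Q: "w \<in> V" "x \<in> V" "x \<notin> Q"
  shows "card {e \<in> incident x. departs Q w x e T} =
    card {e \<in> incident x. departs Q w (other e x) e T} + (if x = w then 1 else 0)"
proof -
  have fT: "forest T" and un: "\<And>v r r'. v \<in> V \<Longrightarrow> r \<in> Q \<Longrightarrow> conn T v r \<Longrightarrow> r' \<in> Q \<Longrightarrow> conn T v r' \<Longrightarrow> r = r'"
    using T unfolding rooted_forests_def by blast+
  obtain r where r: "r \<in> Q" "conn T w r" using T Q unfolding rooted_forests_def by blast
  have TE: "T \<subseteq> E" using fT forest_subset_E by blast
  have m: "\<And>a b e. conn (T - {e}) a b \<Longrightarrow> conn T a b" by (rule conn_mono) auto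
  \<comment> \<open>Only one root lies in the tree of \<open>w\<close>, so being cut off from
    \<open>Q\<close> means being cut off from \<open>r\<close>.\<close>
  have dep: "departs Q w z e T \<longleftrightarrow> e \<in> T \<and> conn (T - {e}) w z \<and> \<not> conn (T - {e}) w r" for e z
    using r un[OF Q(1)] m unfolding departs_def by metis
  have inT: "e \<in> incident x \<and> e \<in> T \<longleftrightarrow> e \<in> T \<and> (s e = x \<or> t e = x)" for e
    using TE by (auto simp: incident_def)
  have nxy: "\<not> conn (T - {e}) x (other e x)" if "e \<in> T" "e \<in> incident x" for e
    using forest_joins[OF fT that(1) joins_other[OF that(2)]] .
  show ?thesis
  proof (cases "conn T x w")
    case False
    then have nw: "\<not> conn T w x" using conn_sym by blast
    have "\<not> departs Q w x e T" for e using nw m by (auto simp: dep)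
    moreover have "\<not> departs Q w (other e x) e T" if "e \<in> incident x" for e
      using nw m conn_joins[OF _ joins_other[OF that]] unfolding dep
      by (meson conn_sym conn_trans)
    moreover have "x \<noteq> w" using False by auto
    ultimately show ?thesis by (auto simp: card_eq_0_iff)
  next
    case True
    have xr: "conn T x r" "x \<noteq> r" using True r Q by (auto intro: conn_trans)
    \<comment> \<open>\<open>er\<close> is the edge at \<open>x\<close> that leads towards the
      root.\<close>
    obtain er where er: "\<And>f. f \<in> T \<Longrightarrow> s f = x \<or> t f = x \<Longrightarrow> \<not> conn (T - {f}) x r \<longleftrightarrow> f = er"
      "er \<in> T" "s er = x \<or> t er = x"
      using unique_separating_edge[OF fT xr] by metis
    show ?thesis
    proof (cases "x = w")
      case xw: True
      have near: "{e \<in> incident x. departs Q w x e T} = {er}"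
        using er inT by (auto simp: dep xw)
      have far: "{e \<in> incident x. departs Q w (other e x) e T} = {}"
        using nxy by (auto simp: dep xw)
      show ?thesis unfolding near far using xw by simp
    next
      case xw: False
      \<comment> \<open>\<open>ew\<close> leads from \<open>x\<close> towards \<open>w\<close>. The
        path from \<open>w\<close> to \<open>r\<close> meets \<open>x\<close> exactly if
        \<open>er\<close> and \<open>ew\<close> differ; it then arrives along \<open>ew\<close> and
        departs along \<open>er\<close>.\<close>
      obtain ew where ew: "\<And>f. f \<in> T \<Longrightarrow> s f = x \<or> t f = x \<Longrightarrow> \<not> conn (T - {f}) x w \<longleftrightarrow> f = ew"
        "ew \<in> T" "s ew = x \<or> t ew = x"
        using unique_separating_edge[OF fT True xw] by metis
      have side: "conn (T - {e}) x v \<longleftrightarrow> \<not> conn (T - {e}) v (other e x)"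
        if e: "e \<in> T" "e \<in> incident x" and v: "conn T x v" for e v
      proof -
        have "insert e (T - {e}) = T" using e by auto
        then have "conn (T - {e}) x v \<or> conn (T - {e}) (other e x) v"
          using v conn_insert[OF joins_other[OF e(2)], of "T - {e}" x v] by auto
        then show ?thesis using nxy[OF e] by (meson conn_sym conn_trans)
      qed
      have sep: "conn (T - {e}) x w \<longleftrightarrow> e \<noteq> ew" "conn (T - {e}) x r \<longleftrightarrow> e \<noteq> er"
        if "e \<in> T" "e \<in> incident x" for e
        using er(1) ew(1) that by (auto simp: incident_def)
      have near: "e \<in> incident x \<and> departs Q w x e T \<longleftrightarrow> e = er \<and> er \<noteq> ew" for e
      proof -
        have "conn (T - {e}) w x \<and> \<not> conn (T - {e}) w r \<longleftrightarrow> e = er \<and> er \<noteq> ew"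
          if e: "e \<in> T" "e \<in> incident x"
        proof -
          have "conn (T - {e}) w r \<longleftrightarrow> conn (T - {e}) x r" if "conn (T - {e}) x w"
            using that by (meson conn_sym conn_trans)
          then show ?thesis using sep[OF e] conn_commute[of "T - {e}" w x] by auto
        qed
        then show ?thesis using er(2,3) inT[of er] unfolding dep by blast
      qed
      have far: "e \<in> incident x \<and> departs Q w (other e x) e T \<longleftrightarrow> e = ew \<and> er \<noteq> ew" for e
      proof -
        have "conn (T - {e}) w (other e x) \<and> \<not> conn (T - {e}) w r \<longleftrightarrow> e = ew \<and> er \<noteq> ew"
          if e: "e \<in> T" "e \<in> incident x"
        proof -
          have "conn (T - {e}) w (other e x) \<longleftrightarrow> \<not> conn (T - {e}) x w"
            using side[OF e True] by blast
          moreover have "\<not> conn (T - {e}) w r \<longleftrightarrow> conn (T - {e}) x r" if "\<not> conn (T - {e}) x w"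
            using that side[OF e True] side[OF e xr(1)] by (meson conn_sym conn_trans)
          ultimately show ?thesis using sep[OF e] by auto
        qed
        then show ?thesis using ew(2,3) inT[of ew] unfolding dep by blast
      qed
      have "{e \<in> incident x. departs Q w x e T} = (if er = ew then {} else {er})"
        unfolding near by auto
      moreover have "{e \<in> incident x. departs Q w (other e x) e T} = (if er = ew then {} else {ew})"
        unfolding far by auto
      ultimately show ?thesis using xw by simp
    qed
  qed
qed

text \<open>Kirchhoff's current law: by \<open>card_insert_edge\<close> the difference of
  \<open>green\<close> across an edge is the net number of root paths crossing it, and by
  \<open>card_departs\<close> these paths are conserved at \<open>x\<close>, apart from the one that
  each forest starts at \<open>w\<close>.\<close>

lemma green_laplacian:
  assumes Q: "Q \<subseteq> V" "w \<in> V" "w \<notin> Q" and x: "x \<in> V" "x \<notin> Q"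
  shows "(\<Sum>e\<in>incident x. real (green Q w x) - real (green Q w (other e x))) =
    (if x = w then real (card (rooted_forests Q)) else 0)"
proof -
  let ?R = "rooted_forests (insert w Q)" and ?D = "\<lambda>x e. {T \<in> rooted_forests Q. departs Q w x e T}"
  have *: "real (green Q w x) - real (green Q w (other e x)) =
      real (card (?D x e)) - real (card (?D (other e x) e))" if e: "e \<in> incident x" for e
  proof -
    let ?y = "other e x"
    have eE: "e \<in> E" using e by (simp add: incident_def)
    \<comment> \<open>Forests with both ends of \<open>e\<close> in the tree of \<open>w\<close>
      occur in both terms and cancel.\<close>
    have split: "card {F \<in> ?R. conn F w a} =
        card {F \<in> ?R. conn F w a \<and> conn F w b} + card {F \<in> ?R. conn F w a \<and> \<not> conn F w b}" for a b
      by (subst card_Un_disjoint[symmetric])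
        (auto simp: finite_rooted_forests intro!: arg_cong[where f = card])
    have "card {F \<in> ?R. conn F w x \<and> conn F w ?y} = card {F \<in> ?R. conn F w ?y \<and> conn F w x}"
      by (intro arg_cong[where f = card]) auto
    then show ?thesis
      unfolding green_def split[of x ?y] split[of ?y x]
        card_insert_edge[OF Q eE joins_other[OF e]]
        card_insert_edge[OF Q eE joins_sym[OF joins_other[OF e]]] by simp
  qed
  have "(\<Sum>e\<in>incident x. card (?D x e)) =
      (\<Sum>T\<in>rooted_forests Q. card {e \<in> incident x. departs Q w x e T})"
    by (rule sum_card_swap[OF finite_incident finite_rooted_forests])
  also have "\<dots> = (\<Sum>T\<in>rooted_forests Q. card {e \<in> incident x. departs Q w (other e x) e T} +
      (if x = w then 1 else 0))"
    by (intro sum.cong refl card_departs Q x)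
  also have "\<dots> = (\<Sum>T\<in>rooted_forests Q. card {e \<in> incident x. departs Q w (other e x) e T}) +
      (if x = w then card (rooted_forests Q) else 0)"
    by (simp add: sum.distrib)
  also have "(\<Sum>T\<in>rooted_forests Q. card {e \<in> incident x. departs Q w (other e x) e T}) =
      (\<Sum>e\<in>incident x. card (?D (other e x) e))"
    by (rule sum_card_swap[OF finite_incident finite_rooted_forests, symmetric])
  finally have "(\<Sum>e\<in>incident x. real (card (?D x e))) =
      (\<Sum>e\<in>incident x. real (card (?D (other e x) e))) +
      (if x = w then real (card (rooted_forests Q)) else 0)"
    by (simp flip: of_nat_sum)
  then show ?thesis by (simp add: * sum_subtractf)
qed

lemma sum_incident:
  "(\<Sum>x\<in>V. \<Sum>e\<in>incident x. \<phi> x e) = (\<Sum>e\<in>E. \<phi> (s e) e + \<phi> (t e) e :: real)"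
proof -
  have "(\<Sum>x\<in>V. \<Sum>e\<in>incident x. \<phi> x e) = (\<Sum>e\<in>E. \<Sum>x\<in>{x \<in> V. s e = x \<or> t e = x}. \<phi> x e)"
    unfolding incident_def by (rule sum.swap_restrict[OF finite_V finite_E])
  also have "\<dots> = (\<Sum>e\<in>E. \<phi> (s e) e + \<phi> (t e) e)"
  proof (rule sum.cong[OF refl])
    fix e assume e: "e \<in> E"
    then have "{x \<in> V. s e = x \<or> t e = x} = {s e, t e}" using s_in t_in by auto
    then show "(\<Sum>x\<in>{x \<in> V. s e = x \<or> t e = x}. \<phi> x e) = \<phi> (s e) e + \<phi> (t e) e"
      using s_neq_t[OF e] by simp
  qed
  finally show ?thesis .
qed

lemma other_s [simp]: "other e (s e) = t e"
  by (simp add: other_def)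

lemma other_t [simp]: "e \<in> E \<Longrightarrow> other e (t e) = s e"
  using s_neq_t by (auto simp: other_def)

text \<open>Summation by parts: each edge is met once from either end.\<close>

lemma dirichlet_energy:
  "(\<Sum>x\<in>V. f x * (\<Sum>e\<in>incident x. f x - f (other e x))) = (\<Sum>e\<in>E. (f (s e) - f (t e) :: real)\<^sup>2)"
  unfolding sum_distrib_left sum_incident
  by (intro sum.cong) (auto simp: power2_eq_square algebra_simps)

section \<open>Spanning trees, two-forests and relations between their counts\<close>

definition trees :: "'e set set" where
  "trees = {T. forest T \<and> (\<forall>x\<in>V. \<forall>y\<in>V. conn T x y)}"

text \<open>These are the two-forests, given by one representative per component; see
  \<open>two_forests_eq\<close>.\<close>

definition tree_pairs :: "'e set set" where
  "tree_pairs = {F. forest F \<and> (\<exists>a\<in>V. \<exists>b\<in>V. \<not> conn F a b \<and> (\<forall>v\<in>V. conn F v a \<or> conn F v b))}"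

lemma finite_trees: "finite trees"
  by (rule finite_subset[of _ "Pow E"]) (auto simp: trees_def finite_E dest: forest_subset_E)

lemma finite_tree_pairs: "finite tree_pairs"
  by (rule finite_subset[of _ "Pow E"])
    (auto simp: tree_pairs_def finite_E dest: forest_subset_E)

lemma rooted_forests_single: "q \<in> V \<Longrightarrow> rooted_forests {q} = trees"
proof -
  assume q: "q \<in> V"
  have "(\<exists>!r. r \<in> {q} \<and> conn F v r) \<longleftrightarrow> conn F v q" for F v by auto
  moreover have "(\<forall>v\<in>V. conn F v q) \<longleftrightarrow> (\<forall>x\<in>V. \<forall>y\<in>V. conn F x y)" for F
    using q by (meson conn_sym conn_trans)
  ultimately show ?thesis unfolding rooted_forests_def trees_def by simp
qed

text \<open>There are only two components, so two separated vertices represent both of them.\<close>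

lemma tree_pairs_cases:
  assumes "F \<in> tree_pairs" "a \<in> V" "b \<in> V" "c \<in> V" "\<not> conn F a b"
  shows "conn F c a \<longleftrightarrow> \<not> conn F c b"
  using assms unfolding tree_pairs_def by (smt (verit) conn_sym conn_trans mem_Collect_eq)

lemma rooted_forests_pair:
  assumes "w \<in> V" "q \<in> V" "w \<noteq> q"
  shows "rooted_forests {w, q} = {F \<in> tree_pairs. \<not> conn F w q}"
proof safe
  fix F assume F: "F \<in> rooted_forests {w, q}"
  then have nc: "\<not> conn F w q"
    using assms conn_refl[of F w] unfolding rooted_forests_def by blast
  then show "F \<in> tree_pairs" using F assms unfolding rooted_forests_def tree_pairs_def by blast
  show "conn F w q \<Longrightarrow> False" using nc by blast
next
  fix F assume F: "F \<in> tree_pairs" "\<not> conn F w q"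
  have "\<exists>!r. r \<in> {w, q} \<and> conn F v r" if "v \<in> V" for v
    using tree_pairs_cases[OF F(1) assms(1,2) that F(2)] by blast
  then show "F \<in> rooted_forests {w, q}" using F by (simp add: rooted_forests_def tree_pairs_def)
qed

text \<open>This is \<open>g x y\<close> for the root \<open>q\<close>. It extends
  \<open>green {q}\<close> by the value 0 at \<open>x = q\<close>, where \<open>green {q} q\<close>
  would count spanning trees instead.\<close>

definition away :: "'v \<Rightarrow> 'v \<Rightarrow> 'v \<Rightarrow> nat" where
  "away q x y = card {F \<in> tree_pairs. \<not> conn F x q \<and> conn F x y}"

lemma away_eq_green:
  assumes "w \<in> V" "q \<in> V" "w \<noteq> q"
  shows "away q w x = green {q} w x"
  unfolding away_def green_def rooted_forests_pair[OF assms]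
  by (intro arg_cong[where f = card]) auto

lemma away_commute: "away q x y = away q y x"
  unfolding away_def by (intro arg_cong[where f = card]) (auto intro: conn_sym conn_trans)

lemma away_root [simp]: "away q q y = 0" "away q y q = 0"
  by (simp_all add: away_def)

lemma card_rooted_forests_pair:
  assumes "w \<in> V" "q \<in> V" "w \<noteq> q"
  shows "card (rooted_forests {w, q}) = away q w w"
  unfolding away_def rooted_forests_pair[OF assms] by simp

definition separating :: "'e \<Rightarrow> nat" where
  "separating e = card {F \<in> tree_pairs. \<not> conn F (s e) (t e)}"

text \<open>Adding \<open>e\<close> to a two-forest that separates its ends yields a spanning tree
  through \<open>e\<close>: this is \<open>card_insert_edge\<close> with \<open>Q = {t e}\<close>
  and \<open>w = x = s e\<close>.\<close>

lemma separating_eq_card_trees: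
  assumes e: "e \<in> E"
  shows "separating e = card {T \<in> trees. e \<in> T}"
proof -
  have st: "s e \<in> V" "t e \<in> V" "s e \<noteq> t e" using e s_in t_in s_neq_t by auto
  have "separating e = card {F \<in> rooted_forests {s e, t e}. conn F (s e) (s e) \<and> \<not> conn F (s e) (t e)}"
    unfolding separating_def rooted_forests_pair[OF st] by (intro arg_cong[where f = card]) auto
  also have "\<dots> = card {T \<in> rooted_forests {t e}. departs {t e} (s e) (s e) e T}"
    by (rule card_insert_edge) (use st e joins_ends in auto)
  also have "{T \<in> rooted_forests {t e}. departs {t e} (s e) (s e) e T} = {T \<in> trees. e \<in> T}"
    unfolding rooted_forests_single[OF st(2)] by (auto simp: departs_def trees_def forest_def)
  finally show ?thesis .
qed

text \<open>The effective resistance of \<open>e\<close> through the Green function. It holds forest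
  by forest: separated ends have exactly one of them away from \<open>q\<close>, joined ends both or
  neither.\<close>

lemma separating_eq_away:
  assumes e: "e \<in> E" and q: "q \<in> V"
  shows "real (separating e) =
    real (away q (s e) (s e)) + real (away q (t e) (t e)) - 2 * real (away q (s e) (t e))"
proof -
  have st: "s e \<in> V" "t e \<in> V" using e s_in t_in by auto
  have "(\<Sum>F\<in>tree_pairs. of_bool (\<not> conn F (s e) (t e)) :: real) =
    (\<Sum>F\<in>tree_pairs. of_bool (\<not> conn F (s e) q \<and> conn F (s e) (s e)) +
      of_bool (\<not> conn F (t e) q \<and> conn F (t e) (t e)) -
      2 * of_bool (\<not> conn F (s e) q \<and> conn F (s e) (t e)))"
  proof (intro sum.cong refl)
    fix F assume F: "F \<in> tree_pairs"
    show "of_bool (\<not> conn F (s e) (t e)) =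
      of_bool (\<not> conn F (s e) q \<and> conn F (s e) (s e)) +
      of_bool (\<not> conn F (t e) q \<and> conn F (t e) (t e)) -
      (2 * of_bool (\<not> conn F (s e) q \<and> conn F (s e) (t e)) :: real)"
    proof (cases "conn F (s e) (t e)")
      case True
      then have "conn F (s e) q \<longleftrightarrow> conn F (t e) q" by (meson conn_sym conn_trans)
      then show ?thesis using True by simp
    next
      case False
      then have "conn F (s e) q \<longleftrightarrow> \<not> conn F (t e) q"
        using tree_pairs_cases[OF F st q] conn_sym by blast
      then show ?thesis using False by simp
    qed
  qed
  then show ?thesis unfolding separating_def away_def
    by (simp add: real_card_filter finite_tree_pairs sum.distrib sum_subtractf sum_distrib_left
        del: sum_of_bool_eq)
qed

text \<open>This is \<open>N e\<close>; as \<open>e\<close> belongs to \<open>F\<close>, both its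
  ends are away from \<open>q\<close> once \<open>s e\<close> is.\<close>

definition containing_away :: "'v \<Rightarrow> 'e \<Rightarrow> nat" where
  "containing_away q e = card {F \<in> tree_pairs. e \<in> F \<and> \<not> conn F (s e) q}"

text \<open>The part of a two-forest not containing \<open>q\<close> is a tree, so it has one vertex more than edges.\<close>

lemma card_tree_pairs:
  assumes q: "q \<in> V"
  shows "real (card tree_pairs) = (\<Sum>v\<in>V. real (away q v v)) - (\<Sum>e\<in>E. real (containing_away q e))"
proof -
  have 1: "card {v \<in> V. \<not> conn F v q \<and> conn F v v} = 1 + card {e \<in> E. e \<in> F \<and> \<not> conn F (s e) q}"
    if F: "F \<in> tree_pairs" for F
  proof -
    have fF: "forest F" using F by (simp add: tree_pairs_def)
    obtain a where a: "a \<in> V" "\<not> conn F a q"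
      using F unfolding tree_pairs_def by (smt (verit) conn_sym conn_trans mem_Collect_eq)
    have eq: "\<not> conn F v q \<longleftrightarrow> conn F a v" if "v \<in> V" for v
      using tree_pairs_cases[OF F a(1) q that a(2)] conn_sym by blast
    have "{v \<in> V. \<not> conn F v q \<and> conn F v v} = {v \<in> V. conn F a v}" using eq by auto
    moreover have "{e \<in> E. e \<in> F \<and> \<not> conn F (s e) q} = {e \<in> F. conn F a (s e)}"
      using eq s_in forest_subset_E[OF fF] by auto
    ultimately show ?thesis using card_component[OF fF a(1)] by simp
  qed
  have "(\<Sum>v\<in>V. away q v v) = (\<Sum>F\<in>tree_pairs. card {v \<in> V. \<not> conn F v q \<and> conn F v v})"
    unfolding away_def by (rule sum_card_swap[OF finite_V finite_tree_pairs])
  also have "\<dots> = (\<Sum>F\<in>tree_pairs. 1 + card {e \<in> E. e \<in> F \<and> \<not> conn F (s e) q})"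
    by (intro sum.cong refl 1)
  also have "\<dots> = card tree_pairs + (\<Sum>F\<in>tree_pairs. card {e \<in> E. e \<in> F \<and> \<not> conn F (s e) q})"
    by (simp only: sum.distrib sum_constant) simp
  also have "(\<Sum>F\<in>tree_pairs. card {e \<in> E. e \<in> F \<and> \<not> conn F (s e) q}) = (\<Sum>e\<in>E. containing_away q e)"
    unfolding containing_away_def by (rule sum_card_swap[OF finite_tree_pairs finite_E])
  finally show ?thesis by (simp flip: of_nat_sum)
qed

text \<open>Deleting \<open>e\<close> splits the tree away from \<open>q\<close> in two, leaving a
  forest rooted at \<open>s e\<close>, \<open>t e\<close> and \<open>q\<close>. So
  \<open>card_insert_edge\<close> applies with \<open>Q = {t e, q}\<close>.\<close>

lemma containing_away_eq_green:
  assumes e: "e \<in> E" and q: "q \<in> V" "s e \<noteq> q" "t e \<noteq> q"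
  shows "containing_away q e = green {t e, q} (s e) (s e)"
proof -
  have st: "s e \<in> V" "t e \<in> V" "s e \<noteq> t e" using e s_in t_in s_neq_t by auto
  have "green {t e, q} (s e) (s e) =
      card {F \<in> rooted_forests {s e, t e, q}. conn F (s e) (s e) \<and> \<not> conn F (s e) (t e)}"
    unfolding green_def
  proof (intro arg_cong[where f = card] Collect_cong conj_cong refl)
    fix F assume "F \<in> rooted_forests {s e, t e, q}"
    then have "\<not> conn F (s e) (t e)"
      using st conn_refl[of F "s e"] unfolding rooted_forests_def by blast
    then show "conn F (s e) (s e) = (conn F (s e) (s e) \<and> \<not> conn F (s e) (t e))" by simp
  qed
  also have "\<dots> = card {T \<in> rooted_forests {t e, q}. departs {t e, q} (s e) (s e) e T}"
    by (rule card_insert_edge) (use st e q joins_ends in auto)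
  also have "{T \<in> rooted_forests {t e, q}. departs {t e, q} (s e) (s e) e T} =
      {F \<in> tree_pairs. e \<in> F \<and> \<not> conn F (s e) q}"
  proof -
    have "departs {t e, q} (s e) (s e) e F \<and> \<not> conn F (t e) q \<longleftrightarrow> e \<in> F \<and> \<not> conn F (s e) q"
      if F: "F \<in> tree_pairs" for F
    proof (cases "e \<in> F")
      case True
      have fF: "forest F" using F by (simp add: tree_pairs_def)
      have "conn F (s e) (t e)" using conn_joins[OF True joins_ends] .
      then have "conn F (t e) q \<longleftrightarrow> conn F (s e) q" by (meson conn_sym conn_trans)
      moreover have "\<not> conn (F - {e}) (s e) (t e)" using forest_joins[OF fF True joins_ends] .
      moreover have "conn (F - {e}) (s e) q \<Longrightarrow> conn F (s e) q" by (erule conn_mono) auto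
      ultimately show ?thesis using True by (auto simp: departs_def)
    next
      case False
      then show ?thesis by (simp add: departs_def)
    qed
    then show ?thesis unfolding rooted_forests_pair[OF st(2) q(1) q(3)] by blast
  qed
  finally show ?thesis by (simp add: containing_away_def)
qed

text \<open>Count pairs of a spanning tree and one of its edges; every spanning tree has one edge
  fewer than vertices.\<close>

lemma sum_separating:
  assumes "V \<noteq> {}"
  shows "(\<Sum>e\<in>E. real (separating e)) = (real (card V) - 1) * real (card trees)"
proof -
  obtain a where a: "a \<in> V" using assms by blast
  have "(\<Sum>e\<in>E. separating e) = (\<Sum>e\<in>E. card {T \<in> trees. e \<in> T})"
    by (intro sum.cong refl separating_eq_card_trees)
  also have "\<dots> = (\<Sum>T\<in>trees. card {e \<in> E. e \<in> T})"
    by (rule sum_card_swap[OF finite_E finite_trees])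
  also have "real \<dots> = (\<Sum>T\<in>trees. real (card V) - 1)"
    unfolding of_nat_sum
  proof (rule sum.cong[OF refl])
    fix T assume T: "T \<in> trees"
    then have fT: "forest T" and c: "\<And>x y. x \<in> V \<Longrightarrow> y \<in> V \<Longrightarrow> conn T x y"
      by (auto simp: trees_def)
    have "{v \<in> V. conn T a v} = V" "{e \<in> T. conn T a (s e)} = {e \<in> E. e \<in> T}"
      using c a s_in forest_subset_E[OF fT] by auto
    then show "real (card {e \<in> E. e \<in> T}) = real (card V) - 1"
      using card_component[OF fT a] by simp
  qed
  finally show ?thesis by simp
qed

end

section \<open>Connected graphs: the quadratic identity and the bound\<close>

locale connected_oriented_multigraph = oriented_multigraph V E s t
  for V :: "'v set" and E :: "'e set" and s t +
  assumes connected: "x \<in> V \<Longrightarrow> y \<in> V \<Longrightarrow> conn E x y"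
begin

text \<open>The product in the hypothesis treats vertices where \<open>f\<close> vanishes and
  vertices where \<open>f\<close> is harmonic alike. The energy is then 0, so \<open>f\<close> does
  not change along any edge.\<close>

lemma energy_zero_imp_constant:
  fixes f :: "'v \<Rightarrow> real"
  assumes "\<And>x. x \<in> V \<Longrightarrow> f x * (\<Sum>e\<in>incident x. f x - f (other e x)) = 0"
    and "x \<in> V" "y \<in> V"
  shows "f x = f y"
proof -
  have "(\<Sum>e\<in>E. (f (s e) - f (t e))\<^sup>2) = 0"
    unfolding dirichlet_energy[symmetric] by (intro sum.neutral ballI assms(1))
  then have eq: "f (s e) = f (t e)" if "e \<in> E" for e
    using that finite_E by (simp add: sum_nonneg_eq_0_iff)
  show ?thesis using connected[OF assms(2,3)]
    by (induction rule: conn_induct) (auto simp: joins_def dest: eq)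
qed

text \<open>Grounding a further vertex \<open>u\<close> changes the Green function by a rank one update, since
  the difference of both sides is harmonic off \<open>{u, q}\<close> and vanishes there.\<close>

lemma green_update:
  assumes V: "q \<in> V" "u \<in> V" "w \<in> V" "x \<in> V" and ne: "u \<noteq> q" "w \<noteq> q" "w \<noteq> u"
  shows "real (card trees) * real (green {u, q} w x) =
    real (away q w x) * real (away q u u) - real (away q w u) * real (away q u x)"
proof -
  define D where "D x = real (card trees) * real (green {u, q} w x) -
    (real (green {q} w x) * real (away q u u) - real (away q w u) * real (green {q} u x))" for x
  have aw: "away q w y = green {q} w y" "away q u y = green {q} u y" for y
    using away_eq_green V ne by auto
  have g0: "green {u, q} w r = 0" if "r = u \<or> r = q" for r
  proof -
    have "\<not> conn F w r" if "F \<in> rooted_forests (insert w {u, q})" for F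
      using that \<open>r = u \<or> r = q\<close> V ne conn_refl[of F w] unfolding rooted_forests_def by blast
    then show ?thesis by (auto simp: green_def card_eq_0_iff)
  qed
  have Dq: "D q = 0" using g0[of q] by (simp add: D_def flip: aw)
  have Du: "D u = 0" using g0[of u] by (simp add: D_def flip: aw)
  have "D y * (\<Sum>e\<in>incident y. D y - D (other e y)) = 0" if y: "y \<in> V" for y
  proof (cases "y = u \<or> y = q")
    case True
    then show ?thesis using Dq Du by auto
  next
    case False
    let ?d = "\<lambda>Q w. \<Sum>e\<in>incident y. real (green Q w y) - real (green Q w (other e y))"
    have "(\<Sum>e\<in>incident y. D y - D (other e y)) =
      real (card trees) * ?d {u, q} w -
      (?d {q} w * real (away q u u) - real (away q w u) * ?d {q} u)"
      unfolding D_def sum_distrib_left sum_distrib_right sum_subtractf[symmetric]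
      by (intro sum.cong refl) (simp add: algebra_simps)
    \<comment> \<open>At \<open>y = w\<close> both Green functions of source \<open>w\<close>
      contribute \<open>card trees * away q u u\<close>, and these cancel; the source
      \<open>u\<close> is excluded by the case.\<close>
    also have "?d {u, q} w = (if y = w then real (away q u u) else 0)"
      using green_laplacian[of "{u, q}" w y] V ne False y
      by (simp add: card_rooted_forests_pair)
    also have "?d {q} w = (if y = w then real (card trees) else 0)"
      using green_laplacian[of "{q}" w y] V ne False y by (simp add: rooted_forests_single)
    also have "?d {q} u = 0"
      using green_laplacian[of "{q}" u y] V ne False y by simp
    finally show ?thesis by simp
  qed
  from energy_zero_imp_constant[of D x q, OF this V(4) V(1)] Dq
  show ?thesis by (simp add: D_def aw)
qed

text \<open>This is \<open>green_update\<close> on the diagonal, with \<open>t e\<close> as the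
  second grounded vertex and \<open>w = x = s e\<close>.\<close>

lemma trees_times_containing_away:
  assumes e: "e \<in> E" and q: "q \<in> V"
  shows "real (card trees) * real (containing_away q e) =
    real (away q (s e) (s e)) * real (away q (t e) (t e)) - (real (away q (s e) (t e)))\<^sup>2"
proof (cases "s e = q \<or> t e = q")
  case True
  \<comment> \<open>If \<open>e\<close> ends in \<open>q\<close>, both sides are 0: a forest using
    \<open>e\<close> has both its ends in the component of \<open>q\<close>.\<close>
  have "conn F (s e) q" if "e \<in> F" for F
    using True conn_joins[OF that joins_ends] by auto
  then have "containing_away q e = 0" by (auto simp: containing_away_def card_eq_0_iff)
  then show ?thesis using True by auto
next
  case False
  then show ?thesis
    using green_update[of q "t e" "s e" "s e"] e q s_in t_in s_neq_t
    by (simp add: containing_away_eq_green power2_eq_square away_commute[of q "t e" "s e"])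
qed

text \<open>The Laplacian of \<open>away q v\<close> at \<open>v\<close> itself equals
  \<open>card trees\<close>. Its off-diagonal values are eliminated by
  \<open>separating_eq_away\<close>, and the equation is multiplied by \<open>away q v v\<close>,
  which makes it trivial at \<open>v = q\<close>.\<close>

lemma trees_times_away:
  assumes q: "q \<in> V" and v: "v \<in> V"
  shows "real (card trees) * real (away q v v) = (\<Sum>e\<in>incident v. real (away q v v) *
    (real (separating e) + real (away q v v) - real (away q (other e v) (other e v))) / 2)"
proof (cases "v = q")
  case False
  have "real (card trees) =
      (\<Sum>e\<in>incident v. real (away q v v) - real (away q v (other e v)))"
    using green_laplacian[of "{q}" v v] q v False
    by (simp add: away_eq_green rooted_forests_single)
  also have "\<dots> = (\<Sum>e\<in>incident v.
      (real (separating e) + real (away q v v) - real (away q (other e v) (other e v))) / 2)"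
  proof (rule sum.cong[OF refl])
    fix e assume "e \<in> incident v"
    then have "e \<in> E" "v = s e \<or> v = t e" by (auto simp: incident_def)
    then show "real (away q v v) - real (away q v (other e v)) =
      (real (separating e) + real (away q v v) - real (away q (other e v) (other e v))) / 2"
      using separating_eq_away[OF _ q] by (auto simp: away_commute)
  qed
  finally have "real (card trees) = (\<Sum>e\<in>incident v.
      (real (separating e) + real (away q v v) - real (away q (other e v) (other e v))) / 2)" .
  then show ?thesis by (simp add: sum_distrib_left mult.commute)
qed simp

lemma trees_times_tree_pairs:
  assumes q: "q \<in> V"
  shows "real (card trees) * real (card tree_pairs) = (\<Sum>e\<in>E. (real (separating e))\<^sup>2 / 4 +
    3 / 4 * (real (away q (s e) (s e)) - real (away q (t e) (t e)))\<^sup>2)"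
proof -
  let ?k = "real (card trees)" and ?h = "\<lambda>v. real (away q v v)" and ?R = "\<lambda>e. real (separating e)"
  have "(\<Sum>v\<in>V. ?k * ?h v) = (\<Sum>v\<in>V. \<Sum>e\<in>incident v. ?h v * (?R e + ?h v - ?h (other e v)) / 2)"
    by (intro sum.cong refl trees_times_away q)
  also have "\<dots> = (\<Sum>e\<in>E. ?h (s e) * (?R e + ?h (s e) - ?h (t e)) / 2 +
      ?h (t e) * (?R e + ?h (t e) - ?h (s e)) / 2)"
    unfolding sum_incident by (intro sum.cong refl) simp
  finally have "?k * real (card tree_pairs) =
      (\<Sum>e\<in>E. ?h (s e) * (?R e + ?h (s e) - ?h (t e)) / 2 +
        ?h (t e) * (?R e + ?h (t e) - ?h (s e)) / 2 - ?k * real (containing_away q e))"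
    unfolding card_tree_pairs[OF q] right_diff_distrib sum_distrib_left sum_subtractf by simp
  \<comment> \<open>With \<open>?R e\<close> and the last term rewritten by \<open>away\<close>,
    this is edge by edge a polynomial identity in the three values of \<open>away\<close> at the
    ends of \<open>e\<close>.\<close>
  also have "\<dots> = (\<Sum>e\<in>E. (?R e)\<^sup>2 / 4 + 3 / 4 * (?h (s e) - ?h (t e))\<^sup>2)"
    by (intro sum.cong refl)
      (simp add: trees_times_containing_away q separating_eq_away[OF _ q] field_simps power2_eq_square)
  finally show ?thesis .
qed

text \<open>A maximal forest already connects the ends of every edge, since otherwise that edge
  could be added.\<close>

lemma trees_nonempty: "trees \<noteq> {}"
proof -
  have fin: "finite {F. forest F}"
    by (rule finite_subset[of _ "Pow E"]) (auto simp: finite_E dest: forest_subset_E)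
  have "forest {}" by (simp add: forest_def)
  then obtain T where T: "forest T" and mx: "\<And>F. forest F \<Longrightarrow> T \<subseteq> F \<Longrightarrow> F = T"
    using finite_has_maximal[OF fin] by auto
  have st: "conn T (s e) (t e)" if "e \<in> E" for e
  proof (rule ccontr)
    assume n: "\<not> conn T (s e) (t e)"
    then have "insert e T = T" using forest_insert[OF T that joins_ends] mx by blast
    then show False using n conn_joins[OF _ joins_ends, of e T] by auto
  qed
  have "conn T x y" if "x \<in> V" "y \<in> V" for x y
    using connected[OF that]
  proof (induction rule: conn_induct)
    case (step y z e)
    then have "conn T y z" using st[of e] by (auto simp: joins_def dest: conn_sym)
    then show ?case using step conn_trans by blast
  qed simp
  then show ?thesis using T by (auto simp: trees_def)
qed

lemma mean_separated_edges:
  assumes n: "card V \<ge> 2"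
  shows "tree_pairs \<noteq> {}"
    and "(\<Sum>F\<in>tree_pairs. real (card {e \<in> E. \<not> conn F (s e) (t e)})) / real (card tree_pairs)
      \<le> 4 * real (card E) / (real (card V) - 1)"
proof -
  let ?n = "real (card V) - 1" and ?k = "real (card trees)" and ?p = "real (card tree_pairs)"
  obtain q where q: "q \<in> V" using n by fastforce
  have k: "?k > 0" using trees_nonempty finite_trees by (simp add: card_gt_0_iff)
  have n0: "?n > 0" using n by simp
  have S: "(\<Sum>e\<in>E. real (separating e)) = ?n * ?k" using sum_separating q by blast
  have "(\<Sum>e\<in>E. real (separating e))\<^sup>2 \<le> real (card E) * (\<Sum>e\<in>E. (real (separating e))\<^sup>2)"
    using Cauchy_Schwarz_ineq_sum[of "\<lambda>_. 1" "\<lambda>e. real (separating e)" E] by simp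
  \<comment> \<open>The squared differences of \<open>away\<close> in the identity are nonnegative
    and are dropped.\<close>
  also have "(\<Sum>e\<in>E. (real (separating e))\<^sup>2) \<le> 4 * (?k * ?p)"
    unfolding trees_times_tree_pairs[OF q] sum_distrib_left by (intro sum_mono) simp
  finally have "(?n * ?k)\<^sup>2 \<le> real (card E) * (4 * (?k * ?p))"
    unfolding S by (simp add: mult_left_mono)
  then have "?k * (?n * (?n * ?k)) \<le> ?k * (4 * real (card E) * ?p)"
    by (simp add: power2_eq_square algebra_simps)
  then have le: "?n * (?n * ?k) \<le> 4 * real (card E) * ?p" using k by simp
  \<comment> \<open>The same inequality shows that two-forests exist, as its left side is
    positive.\<close>
  have "0 < ?n * (?n * ?k)" using n0 k by simp
  then have p: "?p > 0" using le by (cases "card tree_pairs = 0") auto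
  then show "tree_pairs \<noteq> {}" by auto
  have "(\<Sum>F\<in>tree_pairs. card {e \<in> E. \<not> conn F (s e) (t e)}) = (\<Sum>e\<in>E. separating e)"
    unfolding separating_def by (rule sum_card_swap[OF finite_tree_pairs finite_E])
  then have sum_eq: "(\<Sum>F\<in>tree_pairs. real (card {e \<in> E. \<not> conn F (s e) (t e)})) = ?n * ?k"
    unfolding S[symmetric] by (simp flip: of_nat_sum)
  have "?n * (?n * ?k) / ?p \<le> 4 * real (card E)"
    using le p by (simp only: pos_divide_le_eq)
  moreover have "?n * ?k / ?p * ?n = ?n * (?n * ?k) / ?p" by simp
  ultimately have "?n * ?k / ?p * ?n \<le> 4 * real (card E)" by (simp only:)
  then show "(\<Sum>F\<in>tree_pairs. real (card {e \<in> E. \<not> conn F (s e) (t e)})) / ?p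
      \<le> 4 * real (card E) / ?n"
    unfolding sum_eq using n0 by (simp only: pos_le_divide_eq)
qed

end

section \<open>Paths and cycles as lists; translation to the original graph notions\<close>

context oriented_multigraph
begin

text \<open>Vertices stay distinct because a walk that returns to a visited vertex is cut back to
  that visit.\<close>

lemma conn_imp_simple_path:
  assumes "conn F x y" "F \<subseteq> E" "x \<in> V"
  shows "\<exists>vs es. length vs = Suc (length es) \<and> distinct vs \<and> set vs \<subseteq> V \<and> set es \<subseteq> F \<and>
    vs ! 0 = x \<and> vs ! length es = y \<and> (\<forall>i<length es. joins (es ! i) (vs ! i) (vs ! Suc i))"
  using assms(1)
proof (induction rule: conn_induct)
  case refl
  show ?case by (rule exI[of _ "[x]"], rule exI[of _ "[]"]) (use assms in auto)
next
  case (step y z f)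
  then obtain vs es where p: "length vs = Suc (length es)" "distinct vs" "set vs \<subseteq> V" "set es \<subseteq> F"
    "vs ! 0 = x" "vs ! length es = y" "\<forall>i<length es. joins (es ! i) (vs ! i) (vs ! Suc i)" by blast
  have zV: "z \<in> V" using step.hyps assms s_in t_in by (auto simp: joins_def)
  show ?case
  proof (cases "z \<in> set vs")
    case True
    then obtain j where j: "j < length vs" "vs ! j = z" by (auto simp: in_set_conv_nth)
    show ?thesis
      by (rule exI[of _ "take (Suc j) vs"], rule exI[of _ "take j es"])
        (use p j in \<open>auto dest: in_set_takeD\<close>)
  next
    case False
    show ?thesis
      by (rule exI[of _ "vs @ [z]"], rule exI[of _ "es @ [f]"])
        (use p step.hyps zV False in \<open>auto simp: nth_append less_Suc_eq\<close>)
  qed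
qed

end

locale multigraph_orientation = oriented_multigraph "verts G" "edges G" s t
  for G :: "('v, 'e) multigraph" and s t +
  assumes ends_eq: "e \<in> edges G \<Longrightarrow> ends G e = {s e, t e}"
begin

lemma ends_eq_joins: "e \<in> edges G \<Longrightarrow> ends G e = {u, v} \<longleftrightarrow> joins e u v"
  by (auto simp: ends_eq joins_def doubleton_eq_iff)

lemma spanning_subgraph_simps [simp]:
  "verts (spanning_subgraph G F) = verts G" "edges (spanning_subgraph G F) = F"
  "ends (spanning_subgraph G F) = ends G"
  by (simp_all add: spanning_subgraph_def)

lemma adjacency_conn:
  assumes "F \<subseteq> edges G"
  shows "(u, v) \<in> (adjacency (spanning_subgraph G F))\<^sup>* \<longleftrightarrow> conn F u v"
proof -
  have "adjacency (spanning_subgraph G F) = {(u, v). \<exists>e\<in>F. joins e u v}"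
    using assms by (auto simp: adjacency_def ends_eq_joins subset_iff)
  then show ?thesis by (simp add: conn_def)
qed

lemma graph_components_conn:
  assumes "F \<subseteq> edges G"
  shows "graph_components (spanning_subgraph G F) = (\<lambda>v. {u \<in> verts G. conn F v u}) ` verts G"
  by (simp add: graph_components_def adjacency_conn[OF assms])

text \<open>The other edges of a cycle connect the ends of its closing edge \<open>es ! k\<close>,
  which leads from \<open>vs ! k\<close> back to \<open>vs ! 0\<close>, so this edge is no
  bridge.\<close>

lemma forest_imp_acyclic_graph:
  assumes F: "forest F"
  shows "acyclic_graph (spanning_subgraph G F)"
  unfolding acyclic_graph_def
proof safe
  fix vs es assume c: "is_cycle (spanning_subgraph G F) vs es"
  define k where "k = length es - 1"
  have k: "length es = Suc k" "length vs = Suc k" and d: "distinct es"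
    and es: "set es \<subseteq> F"
    and en: "\<And>i. i < Suc k \<Longrightarrow> ends G (es ! i) = {vs ! i, vs ! (Suc i mod Suc k)}"
    using c by (auto simp: is_cycle_def k_def)
  have inF: "es ! i \<in> F" if "i < Suc k" for i using that es k by (auto simp: subset_iff)
  have jo: "joins (es ! i) (vs ! i) (vs ! (Suc i mod Suc k))" if "i < Suc k" for i
    using en[OF that] ends_eq_joins inF[OF that] forest_subset_E[OF F] by blast
  have "i \<le> k \<Longrightarrow> conn (F - {es ! k}) (vs ! 0) (vs ! i)" for i
  proof (induction i)
    case (Suc i)
    have "es ! i \<noteq> es ! k" using Suc d k by (simp add: nth_eq_iff_index_eq)
    then have "conn (F - {es ! k}) (vs ! i) (vs ! Suc i)"
      using inF[of i] jo[of i] Suc by (intro conn_joins[of "es ! i"]) auto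
    then show ?case using Suc conn_trans by (meson Suc_leD)
  qed simp
  then have "conn (F - {es ! k}) (vs ! 0) (vs ! k)" by simp
  moreover have "joins (es ! k) (vs ! 0) (vs ! k)" using jo[of k] joins_sym by simp
  ultimately show False using forest_joins[OF F inF[of k]] by simp
qed

text \<open>If \<open>e\<close> is no bridge, a simple path between its ends that avoids
  \<open>e\<close> closes up with \<open>e\<close> to a cycle.\<close>

lemma acyclic_graph_imp_forest:
  assumes F: "F \<subseteq> edges G" and ac: "acyclic_graph (spanning_subgraph G F)"
  shows "forest F"
  unfolding forest_def
proof (intro conjI ballI notI F)
  fix e assume e: "e \<in> F" and c: "conn (F - {e}) (s e) (t e)"
  have eE: "e \<in> edges G" using e F by auto
  obtain vs es where p: "length vs = Suc (length es)" "distinct vs" "set vs \<subseteq> verts G"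
    "set es \<subseteq> F - {e}" "vs ! 0 = s e" "vs ! length es = t e"
    "\<forall>i<length es. joins (es ! i) (vs ! i) (vs ! Suc i)"
    using conn_imp_simple_path[OF c] F s_in[OF eE] by blast
  \<comment> \<open>A repeated edge would have the same two ends at positions \<open>i\<close> and
    \<open>j\<close>; distinct vertices force \<open>i = j\<close>, or \<open>i = Suc j\<close>
    together with \<open>Suc i = j\<close>.\<close>
  have "distinct es"
    unfolding distinct_conv_nth
  proof (intro allI impI notI)
    fix i j assume ij: "i < length es" "j < length es" "i \<noteq> j" "es ! i = es ! j"
    then have "vs ! i = vs ! j \<or> vs ! i = vs ! Suc j \<and> vs ! Suc i = vs ! j"
      using p(7) by (metis joins_def)
    then show False using p(1,2) ij by (auto simp: nth_eq_iff_index_eq)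
  qed
  then have "is_cycle (spanning_subgraph G F) vs (es @ [e])"
    unfolding is_cycle_def
  proof (intro conjI allI impI)
    fix i assume i: "i < length (es @ [e])"
    show "ends (spanning_subgraph G F) ((es @ [e]) ! i) =
      {vs ! i, vs ! (Suc i mod length (es @ [e]))}"
    proof (cases "i < length es")
      case True
      then have "es ! i \<in> edges G" using p(4) F nth_mem by blast
      then show ?thesis using True p(7) by (simp add: nth_append ends_eq_joins)
    next
      case False
      then have "i = length es" using i by simp
      then show ?thesis using p(5,6) eE by (auto simp: ends_eq)
    qed
  qed (use p e F in auto)
  then show False using ac by (auto simp: acyclic_graph_def)
qed

text \<open>Two vertices have equal component sets exactly if they are connected, so having two
  components amounts to having two separated representatives that reach every vertex.\<close>

lemma two_forests_eq: "two_forests G = tree_pairs"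
proof -
  have "card (graph_components (spanning_subgraph G F)) = 2 \<longleftrightarrow>
      (\<exists>a\<in>verts G. \<exists>b\<in>verts G. \<not> conn F a b \<and> (\<forall>v\<in>verts G. conn F v a \<or> conn F v b))"
    (is "?L \<longleftrightarrow> ?R") if F: "F \<subseteq> edges G" for F
  proof -
    let ?C = "\<lambda>v. {u \<in> verts G. conn F v u}"
    have eq: "?C v = ?C w \<longleftrightarrow> conn F v w" if "v \<in> verts G" "w \<in> verts G" for v w
    proof
      assume "?C v = ?C w"
      then have "w \<in> ?C v" using that by auto
      then show "conn F v w" by blast
    next
      assume "conn F v w"
      then have "conn F v u \<longleftrightarrow> conn F w u" for u by (meson conn_sym conn_trans)
      then show "?C v = ?C w" by simp
    qed
    have L: "?L \<longleftrightarrow> card (?C ` verts G) = 2" by (simp only: graph_components_conn[OF F])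
    show ?thesis
    proof
      assume ?L
      then have "card (?C ` verts G) = 2" using L by simp
      then obtain X Y where XY: "?C ` verts G = {X, Y}" "X \<noteq> Y" by (metis card_2_iff)
      then have "X \<in> ?C ` verts G" "Y \<in> ?C ` verts G" by simp_all
      then obtain a b where ab: "a \<in> verts G" "b \<in> verts G" "X = ?C a" "Y = ?C b"
        by (elim imageE) (rule that)
      have "\<not> conn F a b" using XY(2) ab eq[OF ab(1,2)] by simp
      moreover have "conn F v a \<or> conn F v b" if "v \<in> verts G" for v
      proof -
        have "?C v \<in> {X, Y}" unfolding XY(1)[symmetric] using that by (rule imageI)
        then show ?thesis using eq[OF that ab(1)] eq[OF that ab(2)] ab(3,4) by simp
      qed
      ultimately show ?R using ab by blast
    next
      assume ?R
      then obtain a b where ab: "a \<in> verts G" "b \<in> verts G" "\<not> conn F a b"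
        "\<And>v. v \<in> verts G \<Longrightarrow> conn F v a \<or> conn F v b" by blast
      have "?C ` verts G \<subseteq> {?C a, ?C b}"
      proof
        fix Z assume "Z \<in> ?C ` verts G"
        then obtain v where v: "v \<in> verts G" "Z = ?C v" by blast
        show "Z \<in> {?C a, ?C b}" using ab(4)[OF v(1)] eq[OF v(1) ab(1)] eq[OF v(1) ab(2)] v(2) by simp
      qed
      moreover have "{?C a, ?C b} \<subseteq> ?C ` verts G" using ab(1,2) by simp
      ultimately have "?C ` verts G = {?C a, ?C b}" by (rule subset_antisym)
      moreover have "?C a \<noteq> ?C b" using eq[OF ab(1,2)] ab(3) by simp
      ultimately show ?L unfolding L by simp
    qed
  qed
  then show ?thesis
    using forest_imp_acyclic_graph acyclic_graph_imp_forest forest_subset_E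
    unfolding two_forests_def tree_pairs_def by blast
qed

lemma cut_set_eq:
  assumes F: "F \<subseteq> edges G"
  shows "cut_set G F = {e \<in> edges G. \<not> conn F (s e) (t e)}"
proof -
  let ?C = "\<lambda>v. {u \<in> verts G. conn F v u}"
  have "(\<exists>A\<in>?C ` verts G. \<exists>B\<in>?C ` verts G. A \<noteq> B \<and> (\<exists>a\<in>A. \<exists>b\<in>B. ends G e = {a, b})) \<longleftrightarrow>
    \<not> conn F (s e) (t e)" (is "?L \<longleftrightarrow> ?R") if e: "e \<in> edges G" for e
  proof
    assume ?L
    then obtain v w a b where *: "v \<in> verts G" "w \<in> verts G" "?C v \<noteq> ?C w" "conn F v a" "conn F w b"
      "joins e a b" unfolding ends_eq_joins[OF e] by blast
    have "\<not> conn F a b"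
    proof
      assume "conn F a b"
      then have "conn F v w" using * by (meson conn_sym conn_trans)
      then have "conn F v u \<longleftrightarrow> conn F w u" for u by (meson conn_sym conn_trans)
      then have "?C v = ?C w" by simp
      then show False using * by blast
    qed
    then show ?R using * by (auto simp: joins_def dest: conn_sym)
  next
    assume n: ?R
    have ins: "s e \<in> ?C (s e)" "t e \<in> ?C (t e)" using s_in[OF e] t_in[OF e] by simp_all
    have "t e \<notin> ?C (s e)" using n by simp
    then have "?C (s e) \<noteq> ?C (t e)" using ins(2) by metis
    then show ?L
      by (intro bexI[OF _ imageI[OF s_in[OF e]]] bexI[OF _ imageI[OF t_in[OF e]]] conjI
          bexI[OF _ ins(1)] bexI[OF _ ins(2)] ends_eq[OF e])
  qed
  then show ?thesis unfolding cut_set_def graph_components_conn[OF F]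
    by (intro Collect_cong conj_cong refl)
qed

end

lemma finite_multigraph_orientation:
  assumes "finite_multigraph G"
  obtains s t where "multigraph_orientation G s t"
proof -
  have "\<exists>a b. ends G e = {a, b} \<and> a \<noteq> b" if "e \<in> edges G" for e
    using assms that by (simp add: finite_multigraph_def card_2_iff)
  then obtain s t where st: "\<And>e. e \<in> edges G \<Longrightarrow> ends G e = {s e, t e}" "\<And>e. e \<in> edges G \<Longrightarrow> s e \<noteq> t e"
    by metis
  have sub: "ends G e \<subseteq> verts G" if "e \<in> edges G" for e
    using assms that by (simp add: finite_multigraph_def)
  have "multigraph_orientation G s t"
  proof
    show "finite (verts G)" "finite (edges G)" using assms by (simp_all add: finite_multigraph_def)
    fix e assume e: "e \<in> edges G"
    show "s e \<in> verts G" "t e \<in> verts G" using sub[OF e] st(1)[OF e] by simp_all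
    show "s e \<noteq> t e" "ends G e = {s e, t e}" using st e by blast+
  qed
  then show thesis by (rule that)
qed

theorem theorem6p2:
  fixes G :: "('v, 'e) multigraph"
  assumes "finite_multigraph G"
    and "connected_graph G"
    and "card (verts G) \<ge> 2"
  shows "measure_pmf.expectation (pmf_of_set (two_forests G)) (\<lambda>F. real (card (cut_set G F)))
    \<le> 2 * avg_deg G * (1 + 1 / (real (card (verts G)) - 1))"
proof -
  obtain s t where "multigraph_orientation G s t"
    using finite_multigraph_orientation[OF assms(1)] .
  then interpret multigraph_orientation G s t .
  have "spanning_subgraph G (edges G) = G" by (simp add: spanning_subgraph_def)
  then have adj: "(u, v) \<in> (adjacency G)\<^sup>* \<longleftrightarrow> conn (edges G) u v" for u v
    using adjacency_conn[OF subset_refl, of u v] by metis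
  interpret connected_oriented_multigraph "verts G" "edges G" s t
    by unfold_locales (use assms(2) in \<open>simp add: connected_graph_def adj\<close>)
  let ?n = "real (card (verts G))" and ?m = "real (card (edges G))"
  have n: "?n \<ge> 2" using assms(3) by simp
  have ne: "two_forests G \<noteq> {}" and fin: "finite (two_forests G)"
    using mean_separated_edges(1)[OF assms(3)] finite_tree_pairs by (simp_all add: two_forests_eq)
  have cut: "cut_set G F = {e \<in> edges G. \<not> conn F (s e) (t e)}" if "F \<in> tree_pairs" for F
    using that cut_set_eq forest_subset_E by (simp add: tree_pairs_def)
  have "measure_pmf.expectation (pmf_of_set (two_forests G)) (\<lambda>F. real (card (cut_set G F))) =
      (\<Sum>F\<in>tree_pairs. real (card {e \<in> edges G. \<not> conn F (s e) (t e)})) / real (card tree_pairs)"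
    using integral_pmf_of_set[OF ne fin] by (simp add: two_forests_eq cut)
  also have "\<dots> \<le> 4 * ?m / (?n - 1)"
    by (rule mean_separated_edges(2)[OF assms(3)])
  \<comment> \<open>The last factor equals \<open>?n / (?n - 1)\<close> and cancels the
    \<open>?n\<close> of the average degree.\<close>
  also have "\<dots> = 2 * (2 * ?m / ?n) * (1 + 1 / (?n - 1))"
    using n by (simp add: field_simps)
  finally show ?thesis by (simp only: avg_deg_eq[OF assms(1)])
qed

end
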